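(* Let $f:\omega\to\omega$ be a permutation and suppose the map $\pi$ on Turing degrees defined by $\pi([A]_{\mathrm T})=[f^*(A)]_{\mathrm T}$ for $A\in 2^\omega$ is an automorphism of the Turing degrees $\mathscr D_2=2^\omega/\equiv_{\mathrm T}$ (ordered by Turing reducibility). Then $\pi(\mathbf p)=\mathbf p$ for every Turing degree $\mathbf p$.
   Context: For $f:\omega\to\omega$, the pullback $f^*:\omega^\omega\to\omega^\omega$ is given by $f^*(A)(n)=A(f(n))$; it maps $2^\omega$ (identified with subsets of $\omega$) into $2^\omega$. An automorphism of the Turing degrees is a bijection $\pi$ of the set of Turing degrees such that $\mathbf x\le\mathbf y$ iff $\pi(\mathbf x)\le\pi(\mathbf y)$. Such a $\pi$ is said to be induced by $f$ if $\pi([A])=[f^*(A)]$ for all $A\in 2^\omega$. *)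

theory Defs
  imports Main
begin

text \<open>
  Turing reducibility is Kleene's: a program denotes a partial function of several
  arguments, built from the basic functions and oracular queries \<open>x \<mapsto> A x\<close> by composition, primitive
  recursion and unbounded search. The recursion or search variable is the first argument.
\<close>

datatype prog =
    Zero
  | Succ
  | Proj nat
  | Query
  | Comp prog "prog list"
  | PrimRec prog prog
  | Mu prog

inductive computes :: "(nat \<Rightarrow> nat) \<Rightarrow> prog \<Rightarrow> nat list \<Rightarrow> nat \<Rightarrow> bool" for A :: "nat \<Rightarrow> nat" where
  zero: "computes A Zero xs 0"
| succ: "computes A Succ [x] (Suc x)"
| proj: "i < length xs \<Longrightarrow> computes A (Proj i) xs (xs ! i)"
| query: "computes A Query [x] (A x)"
| comp: "length ys = length gs \<Longrightarrow> (\<And>i. i < length gs \<Longrightarrow> computes A (gs ! i) xs (ys ! i)) \<Longrightarrow>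
    computes A h ys z \<Longrightarrow> computes A (Comp h gs) xs z"
| rec_0: "computes A g xs y \<Longrightarrow> computes A (PrimRec g h) (0 # xs) y"
| rec_Suc: "computes A (PrimRec g h) (n # xs) r \<Longrightarrow> computes A h (n # r # xs) y \<Longrightarrow>
    computes A (PrimRec g h) (Suc n # xs) y"
| mu: "computes A p (n # xs) 0 \<Longrightarrow> (\<And>m. m < n \<Longrightarrow> \<exists>k. computes A p (m # xs) (Suc k)) \<Longrightarrow>
    computes A (Mu p) xs n"

definition turing_le :: "(nat \<Rightarrow> nat) \<Rightarrow> (nat \<Rightarrow> nat) \<Rightarrow> bool" (infix \<open>\<le>\<^sub>T\<close> 50) where
  "B \<le>\<^sub>T A \<longleftrightarrow> (\<exists>p. \<forall>n. computes A p [n] (B n))"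

text \<open>A subset of \<open>\<omega>\<close> is identified with its characteristic function.\<close>

definition cantor_space :: "(nat \<Rightarrow> nat) set" where
  "cantor_space = {A. \<forall>n. A n \<in> {0, 1}}"

definition turing_equiv :: "((nat \<Rightarrow> nat) \<times> (nat \<Rightarrow> nat)) set" where
  "turing_equiv = {(A, B). A \<in> cantor_space \<and> B \<in> cantor_space \<and> A \<le>\<^sub>T B \<and> B \<le>\<^sub>T A}"

definition turing_degree :: "(nat \<Rightarrow> nat) \<Rightarrow> (nat \<Rightarrow> nat) set" where
  "turing_degree A = turing_equiv `` {A}"

definition turing_degrees :: "(nat \<Rightarrow> nat) set set" where
  "turing_degrees = cantor_space // turing_equiv"

definition degree_le :: "(nat \<Rightarrow> nat) set \<Rightarrow> (nat \<Rightarrow> nat) set \<Rightarrow> bool" where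
  "degree_le a b \<longleftrightarrow> (\<exists>A\<in>a. \<exists>B\<in>b. A \<le>\<^sub>T B)"

definition degree_automorphism :: "((nat \<Rightarrow> nat) set \<Rightarrow> (nat \<Rightarrow> nat) set) \<Rightarrow> bool" where
  "degree_automorphism \<pi> \<longleftrightarrow> bij_betw \<pi> turing_degrees turing_degrees \<and>
     (\<forall>a\<in>turing_degrees. \<forall>b\<in>turing_degrees. degree_le a b \<longleftrightarrow> degree_le (\<pi> a) (\<pi> b))"

definition pullback :: "(nat \<Rightarrow> nat) \<Rightarrow> (nat \<Rightarrow> nat) \<Rightarrow> (nat \<Rightarrow> nat)" where
  "pullback f A = (\<lambda>n. A (f n))"

definition induced_by ::
    "((nat \<Rightarrow> nat) set \<Rightarrow> (nat \<Rightarrow> nat) set) \<Rightarrow> (nat \<Rightarrow> nat) \<Rightarrow> bool" where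
  "induced_by \<pi> f \<longleftrightarrow>
     (\<forall>A\<in>cantor_space. \<pi> (turing_degree A) = turing_degree (pullback f A))"

inductive_cases computes_elims:
  "computes A Zero xs y"
  "computes A Succ xs y"
  "computes A (Proj i) xs y"
  "computes A Query xs y"
  "computes A (Comp h gs) xs y"
  "computes A (PrimRec g h) (0 # xs) y"
  "computes A (PrimRec g h) (Suc n # xs) y"
  "computes A (Mu p) xs y"

lemma computes_unique: "computes A p xs y \<Longrightarrow> computes A p xs z \<Longrightarrow> y = z"
proof (induction arbitrary: z rule: computes.induct)
  case (comp ys gs xs h w)
  from comp.prems obtain ys' where ys': "length ys' = length gs"
    "\<And>i. i < length gs \<Longrightarrow> computes A (gs ! i) xs (ys' ! i)" "computes A h ys' z"
    by (auto elim: computes_elims)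
  have "ys = ys'"
    using comp.hyps comp.IH ys' by (auto intro!: nth_equalityI)
  then show ?case using comp.IH ys' by blast
next
  case (mu p n xs)
  from mu.prems have z: "computes A p (z # xs) 0"
    "\<And>m. m < z \<Longrightarrow> \<exists>k. computes A p (m # xs) (Suc k)"
    by (auto elim: computes_elims)
  have "\<not> n < z" using z(2)[of n] mu.IH(1) by fastforce
  moreover have "\<not> z < n" using z(1) mu.IH(2)[of z] by fastforce
  ultimately show ?case by simp
qed (blast elim: computes_elims)+

fun subst_query :: "prog \<Rightarrow> prog \<Rightarrow> prog" where
  "subst_query q Zero = Zero"
| "subst_query q Succ = Succ"
| "subst_query q (Proj i) = Proj i"
| "subst_query q Query = q"
| "subst_query q (Comp h gs) = Comp (subst_query q h) (map (subst_query q) gs)"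
| "subst_query q (PrimRec g h) = PrimRec (subst_query q g) (subst_query q h)"
| "subst_query q (Mu p) = Mu (subst_query q p)"

lemma computes_subst_query:
  assumes "\<And>n. computes B q [n] (A n)"
  shows "computes A p xs y \<Longrightarrow> computes B (subst_query q p) xs y"
proof (induction rule: computes.induct)
  case (comp ys gs xs h z)
  then show ?case by (auto intro!: computes.comp[of ys])
next
  case (mu p n xs)
  then show ?case by (auto intro!: computes.mu)
qed (auto intro: computes.intros assms)

lemma turing_le_refl: "A \<le>\<^sub>T A"
  unfolding turing_le_def by (blast intro: computes.query)

lemma turing_le_trans: "A \<le>\<^sub>T B \<Longrightarrow> B \<le>\<^sub>T C \<Longrightarrow> A \<le>\<^sub>T C"
  unfolding turing_le_def by (blast intro: computes_subst_query)

lemma equiv_turing_equiv: "equiv cantor_space turing_equiv"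
  by (rule equivI)
    (auto simp: turing_equiv_def refl_on_def sym_def trans_def
      intro: turing_le_refl turing_le_trans)

lemma degree_le_turing_degree:
  assumes "A \<in> cantor_space" "B \<in> cantor_space"
  shows "degree_le (turing_degree A) (turing_degree B) \<longleftrightarrow> A \<le>\<^sub>T B"
  using assms turing_le_refl turing_le_trans
  unfolding degree_le_def turing_degree_def turing_equiv_def by blast

end

theory Submission
  imports Defs "HOL-Analysis.Function_Topology" "HOL-Analysis.Urysohn"
begin

text \<open>
  Let \<open>k = f\<^sup>-\<^sup>1 \<circ> Suc \<circ> f\<close>. The shift of \<open>B\<close> is computable from \<open>B\<close>, so the automorphism
  makes \<open>C \<circ> k\<close> computable from \<open>C\<close> for every \<open>C\<close>. By Baire category a single program does this
  for a dense set of oracles \<open>C\<close> in some cylinder. Computations use finitely many oracle bits, so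
  wherever that program converges on the cylinder, its answer at \<open>n\<close> is the oracle's bit at \<open>k n\<close>.
  Hence \<open>k n\<close> can be found by searching for an oracle and a position such that flipping the bit
  there flips the answer. So \<open>k\<close> is computable, and then so are \<open>f\<^sup>-\<^sup>1(n) = k\<^sup>n(f\<^sup>-\<^sup>1(0))\<close> and \<open>f\<close>;
  therefore \<open>A \<circ> f\<close> and \<open>A\<close> have the same degree.
\<close>

section \<open>Functions recursive in an oracle\<close>

definition recursive_in :: "(nat \<Rightarrow> nat) \<Rightarrow> nat \<Rightarrow> (nat list \<Rightarrow> nat) \<Rightarrow> bool" where
  "recursive_in A n F \<longleftrightarrow> (\<exists>p. \<forall>xs. length xs = n \<longrightarrow> computes A p xs (F xs))"

definition recursive_list_in :: "(nat \<Rightarrow> nat) \<Rightarrow> nat \<Rightarrow> nat \<Rightarrow> (nat list \<Rightarrow> nat list) \<Rightarrow> bool" where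
  "recursive_list_in A n m G \<longleftrightarrow>
     (\<forall>xs. length xs = n \<longrightarrow> length (G xs) = m) \<and> (\<forall>i<m. recursive_in A n (\<lambda>xs. G xs ! i))"

definition decidable_in :: "(nat \<Rightarrow> nat) \<Rightarrow> nat \<Rightarrow> (nat list \<Rightarrow> bool) \<Rightarrow> bool" where
  "decidable_in A n P \<longleftrightarrow> recursive_in A n (\<lambda>xs. of_bool (P xs))"

named_theorems recursive_intros

lemma recursive_in_cong:
  assumes "recursive_in A n F" "\<And>xs. length xs = n \<Longrightarrow> F xs = G xs"
  shows "recursive_in A n G"
  using assms unfolding recursive_in_def by metis

lemma recursive_list_in_length: "recursive_list_in A n m G \<Longrightarrow> length xs = n \<Longrightarrow> length (G xs) = m"
  unfolding recursive_list_in_def by blast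

lemma recursive_in_comp:
  assumes "recursive_in A m H" "recursive_list_in A n m G"
  shows "recursive_in A n (\<lambda>xs. H (G xs))"
proof -
  obtain h where h: "\<And>ys. length ys = m \<Longrightarrow> computes A h ys (H ys)"
    using assms(1) unfolding recursive_in_def by blast
  obtain g where g: "\<And>i xs. i < m \<Longrightarrow> length xs = n \<Longrightarrow> computes A (g i) xs (G xs ! i)"
    using assms(2) unfolding recursive_list_in_def recursive_in_def by metis
  have "computes A (Comp h (map g [0..<m])) xs (H (G xs))" if "length xs = n" for xs
    by (rule computes.comp[of "G xs"]) (use that recursive_list_in_length[OF assms(2)] g h in auto)
  then show ?thesis
    unfolding recursive_in_def by blast
qed

lemma recursive_in_nth [recursive_intros]: "i < n \<Longrightarrow> recursive_in A n (\<lambda>xs. xs ! i)"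
  unfolding recursive_in_def by (metis computes.proj)

lemma recursive_in_nth_drop [recursive_intros]:
  assumes "k + i < n"
  shows "recursive_in A n (\<lambda>xs. drop k xs ! i)"
  by (rule recursive_in_cong[OF recursive_in_nth[OF assms]]) (use assms in simp)

lemma recursive_list_in_nth:
  "recursive_list_in A n m G \<Longrightarrow> i < m \<Longrightarrow> recursive_in A n (\<lambda>xs. G xs ! i)"
  unfolding recursive_list_in_def by blast

lemma recursive_list_in_id [recursive_intros]: "recursive_list_in A n n (\<lambda>xs. xs)"
  unfolding recursive_list_in_def by (simp add: recursive_in_nth)

lemma recursive_list_in_Nil [recursive_intros]: "recursive_list_in A n 0 (\<lambda>xs. [])"
  unfolding recursive_list_in_def by simp

lemma recursive_list_in_Cons [recursive_intros]:
  "recursive_in A n F \<Longrightarrow> recursive_list_in A n m G \<Longrightarrow>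
    recursive_list_in A n (Suc m) (\<lambda>xs. F xs # G xs)"
  unfolding recursive_list_in_def by (auto simp: less_Suc_eq_0_disj)

lemma recursive_list_in_map:
  assumes "\<And>g. g \<in> set gs \<Longrightarrow> recursive_in A n (F g)"
  shows "recursive_list_in A n (length gs) (\<lambda>xs. map (\<lambda>g. F g xs) gs)"
  unfolding recursive_list_in_def by (simp add: assms)

lemma recursive_list_in_drop:
  assumes "recursive_list_in A n (k + m) G"
  shows "recursive_list_in A n m (\<lambda>xs. drop k (G xs))"
  unfolding recursive_list_in_def
proof (intro conjI allI impI)
  show "length (drop k (G xs)) = m" if "length xs = n" for xs
    using recursive_list_in_length[OF assms that] by simp
  show "recursive_in A n (\<lambda>xs. drop k (G xs) ! i)" if "i < m" for i
  proof (rule recursive_in_cong)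
    show "recursive_in A n (\<lambda>xs. G xs ! (k + i))"
      using assms that by (simp add: recursive_list_in_nth)
  qed (simp add: recursive_list_in_length[OF assms])
qed

lemma recursive_in_drop:
  assumes "recursive_in A n F"
  shows "recursive_in A (k + n) (\<lambda>xs. F (drop k xs))"
  using assms by (rule recursive_in_comp) (intro recursive_list_in_drop recursive_list_in_id)

lemma recursive_list_in_comp_drop:
  assumes "recursive_list_in A n m G"
  shows "recursive_list_in A (k + n) m (\<lambda>xs. G (drop k xs))"
  using assms recursive_in_drop[of A n "\<lambda>xs. G xs ! _" k] unfolding recursive_list_in_def by simp

lemma turing_le_iff_recursive_in: "g \<le>\<^sub>T A \<longleftrightarrow> recursive_in A 1 (\<lambda>xs. g (xs ! 0))"
proof -
  have "(\<forall>xs. length xs = 1 \<longrightarrow> computes A p xs (g (xs ! 0))) \<longleftrightarrow> (\<forall>n. computes A p [n] (g n))" for p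
    by (auto simp: length_Suc_conv)
  then show ?thesis
    unfolding turing_le_def recursive_in_def by simp
qed

lemma recursive_in_apply:
  assumes "g \<le>\<^sub>T A" "recursive_in A n F"
  shows "recursive_in A n (\<lambda>xs. g (F xs))"
proof -
  have "recursive_list_in A n 1 (\<lambda>xs. [F xs])"
    using recursive_list_in_Cons[OF assms(2) recursive_list_in_Nil] by simp
  from recursive_in_comp[OF assms(1)[unfolded turing_le_iff_recursive_in] this] show ?thesis
    by simp
qed

lemma recursive_in_apply2:
  assumes "recursive_in A 2 (\<lambda>ys. Q (ys ! 0) (ys ! 1))" "recursive_in A n F" "recursive_in A n G"
  shows "recursive_in A n (\<lambda>xs. Q (F xs) (G xs))"
proof -
  have "recursive_list_in A n 2 (\<lambda>xs. [F xs, G xs])"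
    unfolding numeral_2_eq_2 by (intro recursive_intros assms)
  from recursive_in_comp[OF assms(1) this] show ?thesis
    by simp
qed

lemma turing_le_Suc: "Suc \<le>\<^sub>T A"
  unfolding turing_le_def by (blast intro: computes.succ)

lemma recursive_in_Suc [recursive_intros]:
  "recursive_in A n F \<Longrightarrow> recursive_in A n (\<lambda>xs. Suc (F xs))"
  by (rule recursive_in_apply[OF turing_le_Suc])

lemma recursive_in_const [recursive_intros]: "recursive_in A n (\<lambda>xs. c)"
proof (induction c)
  case 0
  show ?case
    unfolding recursive_in_def using computes.zero by blast
qed (rule recursive_in_Suc)

lemma recursive_in_rec_nat [recursive_intros]:
  assumes "recursive_in A n N" "recursive_in A n G"
    and "recursive_in A (Suc (Suc n)) (\<lambda>ys. H (ys ! 0) (ys ! 1) (drop 2 ys))"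
  shows "recursive_in A n (\<lambda>xs. rec_nat (G xs) (\<lambda>m r. H m r xs) (N xs))"
proof -
  obtain g where g: "\<And>xs. length xs = n \<Longrightarrow> computes A g xs (G xs)"
    using assms(2) unfolding recursive_in_def by blast
  obtain h where h: "\<And>xs. length xs = Suc (Suc n) \<Longrightarrow>
      computes A h xs (H (xs ! 0) (xs ! 1) (drop 2 xs))"
    using assms(3) unfolding recursive_in_def by blast
  have "computes A (PrimRec g h) (m # xs) (rec_nat (G xs) (\<lambda>m r. H m r xs) m)"
    if "length xs = n" for m xs
  proof (induction m)
    case (Suc m)
    show ?case
      using computes.rec_Suc[OF Suc] h[of "m # _ # xs"] that by simp
  qed (simp add: computes.rec_0 g that)
  then have "recursive_in A (Suc n) (\<lambda>ys. rec_nat (G (tl ys)) (\<lambda>m r. H m r (tl ys)) (hd ys))"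
    unfolding recursive_in_def by (intro exI[of _ "PrimRec g h"]) (auto simp: length_Suc_conv)
  from recursive_in_comp[OF this recursive_list_in_Cons[OF assms(1) recursive_list_in_id]]
  show ?thesis
    by simp
qed

lemma recursive_in_funpow:
  assumes "g \<le>\<^sub>T A" "recursive_in A n N" "recursive_in A n F"
  shows "recursive_in A n (\<lambda>xs. (g ^^ N xs) (F xs))"
proof -
  have "rec_nat x (\<lambda>_. g) m = (g ^^ m) x" for x m
    by (induction m) auto
  moreover have "recursive_in A n (\<lambda>xs. rec_nat (F xs) (\<lambda>_. g) (N xs))"
    by (intro recursive_in_rec_nat recursive_in_apply[OF assms(1)] recursive_in_nth assms) simp
  ultimately show ?thesis
    by simp
qed

lemma recursive_in_Least [recursive_intros]:
  assumes "decidable_in A (Suc n) (\<lambda>ys. \<not> P (ys ! 0) (drop 1 ys))"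
    and "\<And>xs. length xs = n \<Longrightarrow> \<exists>w. P w xs"
  shows "recursive_in A n (\<lambda>xs. LEAST w. P w xs)"
proof -
  obtain p where p: "\<And>ys. length ys = Suc n \<Longrightarrow>
      computes A p ys (of_bool (\<not> P (ys ! 0) (drop 1 ys)))"
    using assms(1) unfolding decidable_in_def recursive_in_def by blast
  have "computes A (Mu p) xs (LEAST w. P w xs)" if xs: "length xs = n" for xs
  proof (rule computes.mu)
    have P: "computes A p (w # xs) (of_bool (\<not> P w xs))" for w
      using p[of "w # xs"] xs by simp
    show "computes A p ((LEAST w. P w xs) # xs) 0"
      using P[of "LEAST w. P w xs"] LeastI_ex[OF assms(2)[OF xs]] by simp
    show "\<exists>k. computes A p (m # xs) (Suc k)" if "m < (LEAST w. P w xs)" for m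
      using P[of m] not_less_Least[OF that] by auto
  qed
  then show ?thesis
    unfolding recursive_in_def by blast
qed

lemma recursive_in_if [recursive_intros]:
  assumes "decidable_in A n P" "recursive_in A n F" "recursive_in A n G"
  shows "recursive_in A n (\<lambda>xs. if P xs then F xs else G xs)"
proof (rule recursive_in_cong)
  show "recursive_in A n (\<lambda>xs. rec_nat (G xs) (\<lambda>_ _. F xs) (of_bool (P xs)))"
    using assms(1) recursive_in_drop[OF assms(2), of 2]
    by (intro recursive_in_rec_nat assms(3)) (simp_all add: decidable_in_def)
qed simp

lemma recursive_in_pred [recursive_intros]:
  assumes "recursive_in A n F"
  shows "recursive_in A n (\<lambda>xs. F xs - 1)"
proof (rule recursive_in_cong)
  show "recursive_in A n (\<lambda>xs. rec_nat 0 (\<lambda>m _. m) (F xs))"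
    by (intro recursive_intros assms) simp
  show "rec_nat 0 (\<lambda>m _. m) (F xs) = F xs - 1" for xs
    by (cases "F xs") auto
qed

lemma recursive_in_add [recursive_intros]:
  assumes "recursive_in A n F" "recursive_in A n G"
  shows "recursive_in A n (\<lambda>xs. F xs + G xs)"
proof -
  have "rec_nat a (\<lambda>_. Suc) b = a + b" for a b
    by (induction b) auto
  moreover have "recursive_in A n (\<lambda>xs. rec_nat (F xs) (\<lambda>_. Suc) (G xs))"
    by (intro recursive_intros assms) simp
  ultimately show ?thesis
    by simp
qed

lemma recursive_in_diff [recursive_intros]:
  assumes "recursive_in A n F" "recursive_in A n G"
  shows "recursive_in A n (\<lambda>xs. F xs - G xs)"
proof -
  have "rec_nat a (\<lambda>_ r. r - 1) b = a - b" for a b :: nat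
    by (induction b) auto
  moreover have "recursive_in A n (\<lambda>xs. rec_nat (F xs) (\<lambda>_ r. r - 1) (G xs))"
    by (intro recursive_intros assms) simp
  ultimately show ?thesis
    by simp
qed

lemma decidable_in_not [recursive_intros]:
  assumes "decidable_in A n P"
  shows "decidable_in A n (\<lambda>xs. \<not> P xs)"
  unfolding decidable_in_def
proof (rule recursive_in_cong)
  show "recursive_in A n (\<lambda>xs. 1 - of_bool (P xs))"
    using assms unfolding decidable_in_def by (intro recursive_intros)
qed simp

lemma decidable_in_conj [recursive_intros]:
  assumes "decidable_in A n P" "decidable_in A n Q"
  shows "decidable_in A n (\<lambda>xs. P xs \<and> Q xs)"
proof -
  have "recursive_in A n (\<lambda>xs. if P xs then of_bool (Q xs) else 0)"
    using assms(2) by (intro recursive_intros assms(1)) (simp add: decidable_in_def)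
  then show ?thesis
    unfolding decidable_in_def by (rule recursive_in_cong) simp
qed

lemma decidable_in_disj [recursive_intros]:
  assumes "decidable_in A n P" "decidable_in A n Q"
  shows "decidable_in A n (\<lambda>xs. P xs \<or> Q xs)"
  using decidable_in_not[OF decidable_in_conj[OF assms[THEN decidable_in_not]]] by simp

lemma decidable_in_ball:
  assumes "finite S" "\<And>a. a \<in> S \<Longrightarrow> decidable_in A n (P a)"
  shows "decidable_in A n (\<lambda>xs. \<forall>a\<in>S. P a xs)"
  using assms
proof (induction S)
  case empty
  show ?case
    by (simp add: decidable_in_def recursive_in_const)
next
  case (insert a S)
  then show ?case
    using decidable_in_conj[of A n "P a"] by simp
qed

lemma decidable_in_le [recursive_intros]:
  assumes "recursive_in A n F" "recursive_in A n G"
  shows "decidable_in A n (\<lambda>xs. F xs \<le> G xs)"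
  unfolding decidable_in_def
proof (rule recursive_in_cong)
  show "recursive_in A n (\<lambda>xs. 1 - (F xs - G xs))"
    by (intro recursive_intros assms)
qed auto

lemma decidable_in_less [recursive_intros]:
  assumes "recursive_in A n F" "recursive_in A n G"
  shows "decidable_in A n (\<lambda>xs. F xs < G xs)"
  unfolding Suc_le_eq[symmetric] by (intro recursive_intros assms)

lemma decidable_in_eq [recursive_intros]:
  assumes "recursive_in A n F" "recursive_in A n G"
  shows "decidable_in A n (\<lambda>xs. F xs = G xs)"
  unfolding order_eq_iff by (intro recursive_intros assms)

lemma recursive_in_finite_cases:
  assumes "finite S" "\<And>a. a \<in> S \<Longrightarrow> decidable_in A n (\<lambda>xs. X xs = a)" "recursive_in A n F"
  shows "recursive_in A n (\<lambda>xs. if X xs \<in> S then c (X xs) else F xs)"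
  using assms(1,2)
proof (induction S)
  case (insert a S)
  then have "recursive_in A n
      (\<lambda>xs. if X xs = a then c a else if X xs \<in> S then c (X xs) else F xs)"
    by (intro recursive_in_if[OF _ recursive_in_const]) auto
  then show ?case
    by (rule recursive_in_cong) auto
qed (simp add: assms(3))

lemma decidable_in_mem_finite:
  assumes "finite S" "\<And>a. a \<in> S \<Longrightarrow> decidable_in A n (\<lambda>xs. X xs = a)"
  shows "decidable_in A n (\<lambda>xs. X xs \<in> S)"
  using recursive_in_finite_cases[OF assms recursive_in_const, of "\<lambda>_. 1" 0]
  by (simp add: decidable_in_def of_bool_def)

lemma turing_le_pullback:
  assumes "g \<le>\<^sub>T A" "B \<le>\<^sub>T A"
  shows "pullback g B \<le>\<^sub>T A"
  unfolding pullback_def turing_le_iff_recursive_in[of "\<lambda>n. B (g n)"]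
  by (intro recursive_in_apply[OF assms(2)] recursive_in_apply[OF assms(1)] recursive_in_nth) simp

section \<open>Coding finite sequences\<close>

lemma Least_less_triangle: "(LEAST r. prod_encode (a, b) < triangle (Suc r)) = a + b"
proof (rule Least_equality)
  fix r assume r: "prod_encode (a, b) < triangle (Suc r)"
  have mono: "mono triangle"
    by (rule incseq_SucI) simp
  show "a + b \<le> r"
  proof (rule ccontr)
    assume "\<not> a + b \<le> r"
    then have "triangle (Suc r) \<le> triangle (a + b)"
      by (intro monoD[OF mono]) simp
    with r show False
      by (simp add: prod_encode_def)
  qed
qed (simp add: prod_encode_def)

lemma recursive_in_triangle [recursive_intros]:
  assumes "recursive_in A n F"
  shows "recursive_in A n (\<lambda>xs. triangle (F xs))"
proof -
  have "rec_nat 0 (\<lambda>i r. r + Suc i) m = triangle m" for m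
    by (induction m) auto
  moreover have "recursive_in A n (\<lambda>xs. rec_nat 0 (\<lambda>i r. r + Suc i) (F xs))"
    by (intro recursive_intros assms) simp_all
  ultimately show ?thesis
    by simp
qed

lemma prod_decode_eq_Least:
  defines "r \<equiv> \<lambda>w. LEAST r. w < triangle (Suc r)"
  shows "fst (prod_decode w) = w - triangle (r w)"
    and "snd (prod_decode w) = r w - (w - triangle (r w))"
proof -
  obtain a b where w: "w = prod_encode (a, b)"
    by (metis prod_decode_inverse surj_pair)
  have "r w = a + b"
    unfolding r_def w by (rule Least_less_triangle)
  moreover have "w - triangle (a + b) = a"
    by (simp add: w prod_encode_def)
  ultimately show "fst (prod_decode w) = w - triangle (r w)"
    and "snd (prod_decode w) = r w - (w - triangle (r w))"
    by (simp_all add: w)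
qed

lemma turing_le_prod_decode:
  shows "(\<lambda>w. fst (prod_decode w)) \<le>\<^sub>T A" "(\<lambda>w. snd (prod_decode w)) \<le>\<^sub>T A"
proof -
  have "w \<le> triangle w" for w
    using le_prod_encode_2[of w 0] by (simp add: prod_encode_def)
  then have "\<exists>r. w < triangle (Suc r)" for w
    by (metis Suc_le_eq)
  then have root: "recursive_in A 1 (\<lambda>xs. LEAST r. xs ! 0 < triangle (Suc r))"
    by (intro recursive_intros) simp_all
  show "(\<lambda>w. fst (prod_decode w)) \<le>\<^sub>T A" "(\<lambda>w. snd (prod_decode w)) \<le>\<^sub>T A"
    unfolding turing_le_iff_recursive_in prod_decode_eq_Least
    by (intro recursive_in_diff recursive_in_triangle recursive_in_nth root; simp)+
qed

definition entry :: "nat \<Rightarrow> nat \<Rightarrow> nat" where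
  "entry w i = fst (prod_decode (((\<lambda>v. snd (prod_decode v)) ^^ i) w))"

lemma recursive_in_entry [recursive_intros]:
  "recursive_in A n F \<Longrightarrow> recursive_in A n G \<Longrightarrow> recursive_in A n (\<lambda>xs. entry (F xs) (G xs))"
  unfolding entry_def
  by (intro recursive_in_apply[OF turing_le_prod_decode(1)]
      recursive_in_funpow[OF turing_le_prod_decode(2)])

lemma entry_prod_encode:
  "entry (prod_encode (a, w)) 0 = a" "entry (prod_encode (a, w)) (Suc i) = entry w i"
  by (simp_all add: entry_def funpow_Suc_right del: funpow.simps)

lemma ex_code_ge: "\<exists>w\<ge>s. \<forall>i<u. entry w i = c i"
proof (induction u arbitrary: c)
  case (Suc u)
  obtain w where w: "w \<ge> s" "\<forall>i<u. entry w i = c (Suc i)"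
    using Suc[of "\<lambda>i. c (Suc i)"] by blast
  have "prod_encode (c 0, w) \<ge> s"
    using w(1) le_prod_encode_2 le_trans by blast
  moreover have "entry (prod_encode (c 0, w)) i = c i" if "i < Suc u" for i
    using w(2) that by (cases i) (auto simp: entry_prod_encode)
  ultimately show ?case
    by blast
qed auto

section \<open>Evaluation with bounded search\<close>

text \<open>The result \<open>Suc y\<close> means that \<open>y\<close> was computed with every search stopping at or below \<open>s\<close>,
  and \<open>0\<close> means failure.\<close>

fun bounded_eval :: "(nat \<Rightarrow> nat) \<Rightarrow> nat \<Rightarrow> prog \<Rightarrow> nat list \<Rightarrow> nat" where
  "bounded_eval A s Zero xs = 1"
| "bounded_eval A s Succ xs = (if length xs = 1 then Suc (Suc (xs ! 0)) else 0)"
| "bounded_eval A s (Proj i) xs = (if i < length xs then Suc (xs ! i) else 0)"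
| "bounded_eval A s Query xs = (if length xs = 1 then Suc (A (xs ! 0)) else 0)"
| "bounded_eval A s (Comp h gs) xs =
    (if \<forall>g\<in>set gs. bounded_eval A s g xs \<noteq> 0
     then bounded_eval A s h (map (\<lambda>g. bounded_eval A s g xs - 1) gs) else 0)"
| "bounded_eval A s (PrimRec g h) xs =
    (if length xs = 0 then 0
     else rec_nat (bounded_eval A s g (drop 1 xs))
       (\<lambda>m r. if r = 0 then 0 else bounded_eval A s h (m # (r - 1) # drop 1 xs)) (xs ! 0))"
| "bounded_eval A s (Mu p) xs =
    (let n = LEAST n. s \<le> n \<or> bounded_eval A s p (n # xs) \<le> 1
     in if bounded_eval A s p (n # xs) = 1 then Suc n else 0)"

lemma bounded_eval_PrimRec_sound:
  assumes g: "\<And>xs y. bounded_eval A s g xs = Suc y \<Longrightarrow> computes A g xs y"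
    and h: "\<And>xs y. bounded_eval A s h xs = Suc y \<Longrightarrow> computes A h xs y"
    and eval: "bounded_eval A s (PrimRec g h) xs = Suc y"
  shows "computes A (PrimRec g h) xs y"
proof -
  obtain n zs where xs: "xs = n # zs"
    using eval by (cases xs) auto
  let ?r = "rec_nat (bounded_eval A s g zs)
    (\<lambda>m r. if r = 0 then 0 else bounded_eval A s h (m # (r - 1) # zs))"
  have "?r n = Suc y \<Longrightarrow> computes A (PrimRec g h) (n # zs) y" for n y
  proof (induction n arbitrary: y)
    case 0
    then show ?case
      by (auto intro: computes.rec_0 g)
  next
    case (Suc n)
    then obtain r where "?r n = Suc r"
      by (cases "?r n") auto
    with Suc show ?case
      by (auto intro!: computes.rec_Suc[of _ _ _ _ _ r] h)
  qed
  then show ?thesis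
    using eval xs by (simp cong: if_cong)
qed

lemma bounded_eval_Mu_sound:
  assumes p: "\<And>xs y. bounded_eval A s p xs = Suc y \<Longrightarrow> computes A p xs y"
    and eval: "bounded_eval A s (Mu p) xs = Suc y"
  shows "computes A (Mu p) xs y"
proof (rule computes.mu)
  let ?stop = "\<lambda>n. s \<le> n \<or> bounded_eval A s p (n # xs) \<le> 1"
  from eval have y: "y = Least ?stop" "bounded_eval A s p (y # xs) = 1"
    by (auto simp: Let_def split: if_splits)
  show "computes A p (y # xs) 0"
    using y(2) by (simp add: p)
  show "\<exists>k. computes A p (m # xs) (Suc k)" if "m < y" for m
  proof -
    have "\<not> ?stop m"
      using that y(1) not_less_Least by blast
    then have "bounded_eval A s p (m # xs) = Suc (Suc (bounded_eval A s p (m # xs) - 2))"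
      by linarith
    then show ?thesis
      using p by blast
  qed
qed

lemma bounded_eval_sound: "bounded_eval A s p xs = Suc y \<Longrightarrow> computes A p xs y"
proof (induction p arbitrary: xs y)
  case (Comp h gs)
  let ?ys = "map (\<lambda>g. bounded_eval A s g xs - 1) gs"
  from Comp.prems have gs: "\<forall>g\<in>set gs. bounded_eval A s g xs \<noteq> 0"
    and h: "bounded_eval A s h ?ys = Suc y"
    by (auto split: if_splits)
  show ?case
  proof (rule computes.comp)
    show "computes A (gs ! i) xs (?ys ! i)" if "i < length gs" for i
      using that gs by (auto intro: Comp.IH(2))
    show "computes A h ?ys y"
      using h by (rule Comp.IH(1))
  qed simp
next
  case (PrimRec g h)
  then show ?case
    by (rule bounded_eval_PrimRec_sound)
next
  case (Mu p)
  then show ?case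
    by (rule bounded_eval_Mu_sound)
qed (auto split: if_splits simp: length_Suc_conv intro: computes.intros)

text \<open>The arguments are arbitrary recursive functions \<open>W\<close>, \<open>S\<close>, \<open>G\<close> of a common input, so that the
  induction on programs can substitute into them.\<close>

definition uniformly_evaluable_in :: "(nat \<Rightarrow> nat) \<Rightarrow> (nat \<Rightarrow> nat \<Rightarrow> nat) \<Rightarrow> prog \<Rightarrow> bool" where
  "uniformly_evaluable_in A Q p \<longleftrightarrow> (\<forall>n m W S G.
     recursive_in A n W \<longrightarrow> recursive_in A n S \<longrightarrow> recursive_list_in A n m G \<longrightarrow>
     recursive_in A n (\<lambda>xs. bounded_eval (Q (W xs)) (S xs) p (G xs)))"

lemma recursive_in_bounded_eval:
  assumes "uniformly_evaluable_in A Q p"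
    and "recursive_list_in A n m G" "recursive_in A n W" "recursive_in A n S"
  shows "recursive_in A n (\<lambda>xs. bounded_eval (Q (W xs)) (S xs) p (G xs))"
  using assms unfolding uniformly_evaluable_in_def by blast

lemma uniformly_evaluable_in_Succ: "uniformly_evaluable_in A Q Succ"
  unfolding uniformly_evaluable_in_def
proof (intro allI impI)
  fix n m W S G assume G: "recursive_list_in A n m G"
  have "recursive_in A n (\<lambda>xs. if m = 1 then Suc (Suc (G xs ! 0)) else 0)"
    by (cases "m = 1")
      (simp_all add: recursive_in_Suc recursive_in_const recursive_list_in_nth[OF G])
  then show "recursive_in A n (\<lambda>xs. bounded_eval (Q (W xs)) (S xs) Succ (G xs))"
    by (rule recursive_in_cong) (simp add: recursive_list_in_length[OF G])
qed

lemma uniformly_evaluable_in_Proj: "uniformly_evaluable_in A Q (Proj i)"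
  unfolding uniformly_evaluable_in_def
proof (intro allI impI)
  fix n m W S G assume G: "recursive_list_in A n m G"
  have "recursive_in A n (\<lambda>xs. if i < m then Suc (G xs ! i) else 0)"
    by (cases "i < m")
      (simp_all add: recursive_in_Suc recursive_in_const recursive_list_in_nth[OF G])
  then show "recursive_in A n (\<lambda>xs. bounded_eval (Q (W xs)) (S xs) (Proj i) (G xs))"
    by (rule recursive_in_cong) (simp add: recursive_list_in_length[OF G])
qed

lemma uniformly_evaluable_in_Query:
  assumes "recursive_in A 2 (\<lambda>ys. Q (ys ! 0) (ys ! 1))"
  shows "uniformly_evaluable_in A Q Query"
  unfolding uniformly_evaluable_in_def
proof (intro allI impI)
  fix n m W S G assume W: "recursive_in A n W" and G: "recursive_list_in A n m G"
  have "recursive_in A n (\<lambda>xs. if m = 1 then Suc (Q (W xs) (G xs ! 0)) else 0)"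
    by (cases "m = 1") (simp_all add: recursive_in_Suc recursive_in_const
        recursive_in_apply2[OF assms W recursive_list_in_nth[OF G]])
  then show "recursive_in A n (\<lambda>xs. bounded_eval (Q (W xs)) (S xs) Query (G xs))"
    by (rule recursive_in_cong) (simp add: recursive_list_in_length[OF G])
qed

lemma uniformly_evaluable_in_Comp:
  assumes "uniformly_evaluable_in A Q h" "\<And>g. g \<in> set gs \<Longrightarrow> uniformly_evaluable_in A Q g"
  shows "uniformly_evaluable_in A Q (Comp h gs)"
  unfolding uniformly_evaluable_in_def
proof (intro allI impI)
  fix n m W S G
  assume W: "recursive_in A n W" and S: "recursive_in A n S" and G: "recursive_list_in A n m G"
  have g: "recursive_in A n (\<lambda>xs. bounded_eval (Q (W xs)) (S xs) g (G xs))" if "g \<in> set gs" for g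
    by (rule recursive_in_bounded_eval[OF assms(2)[OF that] G W S])
  then have "recursive_list_in A n (length gs)
      (\<lambda>xs. map (\<lambda>g. bounded_eval (Q (W xs)) (S xs) g (G xs) - 1) gs)"
    by (intro recursive_list_in_map recursive_in_pred)
  from recursive_in_bounded_eval[OF assms(1) this W S] g
  show "recursive_in A n (\<lambda>xs. bounded_eval (Q (W xs)) (S xs) (Comp h gs) (G xs))"
    unfolding bounded_eval.simps
    by (intro recursive_in_if decidable_in_ball decidable_in_not decidable_in_eq
        recursive_in_const) auto
qed

lemma uniformly_evaluable_in_PrimRec:
  assumes g: "uniformly_evaluable_in A Q g" and h: "uniformly_evaluable_in A Q h"
  shows "uniformly_evaluable_in A Q (PrimRec g h)"
  unfolding uniformly_evaluable_in_def
proof (intro allI impI)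
  fix n m W S G
  assume W: "recursive_in A n W" and S: "recursive_in A n S" and G: "recursive_list_in A n m G"
  show "recursive_in A n (\<lambda>xs. bounded_eval (Q (W xs)) (S xs) (PrimRec g h) (G xs))"
  proof (cases m)
    case 0
    show ?thesis
      by (rule recursive_in_cong[OF recursive_in_const[of _ _ 0]])
        (simp add: 0 recursive_list_in_length[OF G])
  next
    case (Suc l)
    have params: "recursive_list_in A n l (\<lambda>xs. drop 1 (G xs))"
      using G by (intro recursive_list_in_drop) (simp add: Suc)
    have weakened: "recursive_in A (Suc (Suc n)) (\<lambda>ys. W (drop 2 ys))"
      "recursive_in A (Suc (Suc n)) (\<lambda>ys. S (drop 2 ys))"
      "recursive_list_in A (Suc (Suc n)) l (\<lambda>ys. drop 1 (G (drop 2 ys)))"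
      using recursive_in_drop[OF W, of 2] recursive_in_drop[OF S, of 2]
        recursive_list_in_comp_drop[OF params, of 2] by simp_all
    have args: "recursive_list_in A (Suc (Suc n)) (Suc (Suc l))
        (\<lambda>ys. ys ! 0 # (ys ! 1 - 1) # drop 1 (G (drop 2 ys)))"
      by (intro recursive_intros weakened) simp_all
    have "recursive_in A n (\<lambda>xs. rec_nat (bounded_eval (Q (W xs)) (S xs) g (drop 1 (G xs)))
        (\<lambda>m r. if r = 0 then 0 else bounded_eval (Q (W xs)) (S xs) h (m # (r - 1) # drop 1 (G xs)))
        (G xs ! 0))"
      by (intro recursive_intros recursive_list_in_nth[OF G] W S weakened
          recursive_in_bounded_eval[OF g params] recursive_in_bounded_eval[OF h args])
        (simp_all add: Suc)
    then show ?thesis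
      by (rule recursive_in_cong) (simp add: Suc recursive_list_in_length[OF G])
  qed
qed

lemma uniformly_evaluable_in_Mu:
  assumes p: "uniformly_evaluable_in A Q p"
  shows "uniformly_evaluable_in A Q (Mu p)"
  unfolding uniformly_evaluable_in_def
proof (intro allI impI)
  fix n m W S G
  assume W: "recursive_in A n W" and S: "recursive_in A n S" and G: "recursive_list_in A n m G"
  have weakened: "recursive_in A (Suc n) (\<lambda>ys. W (drop 1 ys))"
    "recursive_in A (Suc n) (\<lambda>ys. S (drop 1 ys))"
    "recursive_list_in A (Suc n) m (\<lambda>ys. G (drop 1 ys))"
    using recursive_in_drop[OF W, of 1] recursive_in_drop[OF S, of 1]
      recursive_list_in_comp_drop[OF G, of 1] by simp_all
  have args: "recursive_list_in A (Suc n) (Suc m) (\<lambda>ys. ys ! 0 # G (drop 1 ys))"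
    by (intro recursive_intros weakened) simp
  have stop: "recursive_in A n
      (\<lambda>xs. LEAST n. S xs \<le> n \<or> bounded_eval (Q (W xs)) (S xs) p (n # G xs) \<le> 1)"
    by (intro recursive_intros recursive_in_bounded_eval[OF p args] weakened) auto
  show "recursive_in A n (\<lambda>xs. bounded_eval (Q (W xs)) (S xs) (Mu p) (G xs))"
    unfolding bounded_eval.simps Let_def
    by (intro recursive_intros stop W S
        recursive_in_bounded_eval[OF p recursive_list_in_Cons[OF stop G]])
qed

lemma uniformly_evaluable_in_recursive_oracle:
  assumes "recursive_in A 2 (\<lambda>ys. Q (ys ! 0) (ys ! 1))"
  shows "uniformly_evaluable_in A Q p"
proof (induction p)
  case Zero
  show ?case
    by (simp add: uniformly_evaluable_in_def recursive_in_const)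
qed (intro uniformly_evaluable_in_Succ uniformly_evaluable_in_Proj
    uniformly_evaluable_in_Query[OF assms] uniformly_evaluable_in_Comp
    uniformly_evaluable_in_PrimRec uniformly_evaluable_in_Mu; assumption)+

section \<open>Function spaces with the product topology\<close>

lemma open_contains_cylinder:
  fixes U :: "(nat \<Rightarrow> 'a::topological_space) set"
  assumes "open U" "C \<in> U"
  obtains l where "\<And>D. (\<forall>i<l. D i = C i) \<Longrightarrow> D \<in> U"
proof -
  obtain X where X: "C \<in> Pi\<^sub>E UNIV X" "finite {i. X i \<noteq> UNIV}" "Pi\<^sub>E UNIV X \<subseteq> U"
    using product_topology_open_contains_basis[of "\<lambda>_. euclidean" UNIV U C] assms
    by (auto simp: open_fun_def)
  obtain l where "{i. X i \<noteq> UNIV} \<subseteq> {..<l}"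
    using X(2) finite_nat_iff_bounded by blast
  then have l: "\<And>i. X i \<noteq> UNIV \<Longrightarrow> i < l"
    by blast
  have "D \<in> U" if "\<forall>i<l. D i = C i" for D
  proof -
    have "D i \<in> X i" for i
      using X(1) l[of i] that by (cases "X i = UNIV") auto
    then show ?thesis
      using X(3) by auto
  qed
  then show thesis
    by (rule that)
qed

instance "fun" :: (type, t2_space) t2_space
proof
  fix f g :: "'a \<Rightarrow> 'b" assume "f \<noteq> g"
  then obtain i where "f i \<noteq> g i"
    by blast
  then obtain U V where UV: "open U" "open V" "f i \<in> U" "g i \<in> V" "U \<inter> V = {}"
    using hausdorff by metis
  have "open ((\<lambda>h :: 'a \<Rightarrow> 'b. h i) -` U)" "open ((\<lambda>h :: 'a \<Rightarrow> 'b. h i) -` V)"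
    using UV(1,2) by (simp_all add: open_vimage)
  with UV(3-5) show "\<exists>U V. open U \<and> open V \<and> f \<in> U \<and> g \<in> V \<and> U \<inter> V = {}"
    by (metis (no_types, lifting) vimageI vimage_Int vimage_empty)
qed

lemma open_agree_on_finite:
  fixes C :: "'i \<Rightarrow> 'a::discrete_topology"
  assumes "finite I"
  shows "open {D. \<forall>i\<in>I. D i = C i}"
  using product_topology_basis'[OF assms, of "\<lambda>i. {C i}" "\<lambda>i. i"] by (simp add: open_discrete)

lemma continuous_on_fun_upd: "continuous_on UNIV (\<lambda>f :: 'i \<Rightarrow> 'a::topological_space. f(x := a))"
proof (rule continuous_on_coordinatewise_then_product)
  show "continuous_on UNIV (\<lambda>f :: 'i \<Rightarrow> 'a. (f(x := a)) i)" for i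
    by (cases "i = x") simp_all
qed

lemma tendsto_if_agree_below:
  fixes C :: "nat \<Rightarrow> 'a::topological_space"
  assumes "\<And>u i. i < u \<Longrightarrow> D u i = C i"
  shows "D \<longlonglongrightarrow> C"
proof (rule topological_tendstoI)
  fix U assume "open U" "C \<in> U"
  then obtain l where l: "\<And>E. (\<forall>i<l. E i = C i) \<Longrightarrow> E \<in> U"
    using open_contains_cylinder by blast
  have "D u \<in> U" if "l \<le> u" for u
    using that assms by (intro l) simp
  then show "\<forall>\<^sub>F u in sequentially. D u \<in> U"
    by (auto simp: eventually_sequentially)
qed

lemma eventually_nhds_coordinate_eq:
  fixes A :: "'i \<Rightarrow> 'a::discrete_topology"
  shows "\<forall>\<^sub>F B in nhds A. B x = A x"
  unfolding eventually_nhds using open_agree_on_finite[of "{x}" A] by auto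

lemma compact_countable_cover_somewhere_dense:
  fixes S :: "'a::t2_space set" and T :: "'i::countable \<Rightarrow> 'a set"
  assumes "compact S" "S \<noteq> {}" "S = (\<Union>i. T i)"
  obtains i U where "open U" "S \<inter> U \<noteq> {}" "S \<inter> U \<subseteq> closure (T i)"
proof -
  let ?X = "top_of_set S"
  have "Hausdorff_space (euclidean :: 'a topology)"
    using hausdorff by (auto simp: Hausdorff_space_def disjnt_def)
  then have "compact_space ?X" "Hausdorff_space ?X"
    using \<open>compact S\<close> by (auto simp: compact_space_subtopology Hausdorff_space_subtopology)
  then have loc_compact_regular: "locally_compact_space ?X \<and> regular_space ?X"
    by (simp add: compact_imp_locally_compact_space compact_Hausdorff_imp_regular_space)
  have "T i \<subseteq> ?X closure_of T i" for i
    using assms(3) by (intro closure_of_subset) auto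
  moreover have "?X closure_of T i \<subseteq> S" for i
    using closure_of_subset_topspace[of ?X "T i"] by simp
  ultimately have "(\<Union>i. ?X closure_of T i) = S"
    using assms(3) by blast
  then have "?X interior_of (\<Union>i. ?X closure_of T i) \<noteq> {}"
    using \<open>S \<noteq> {}\<close> interior_of_topspace[of ?X] by simp
  moreover have "?X interior_of (\<Union>i. ?X closure_of T i) = {}"
    if "\<And>i. ?X interior_of (?X closure_of T i) = {}"
    using loc_compact_regular that by (intro Baire_category_alt) auto
  ultimately obtain i where nonempty: "?X interior_of (?X closure_of T i) \<noteq> {}"
    by blast
  have "openin ?X (?X interior_of (?X closure_of T i))"
    by (rule openin_interior_of)
  then obtain U where U: "open U" "?X interior_of (?X closure_of T i) = S \<inter> U"
    unfolding openin_open by blast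
  have "S \<inter> U \<subseteq> ?X closure_of T i"
    unfolding U(2)[symmetric] by (rule interior_of_subset)
  also have "\<dots> \<subseteq> closure (T i)"
    using closure_mono[of "S \<inter> T i" "T i"] by (auto simp: closure_of_subtopology)
  finally have "S \<inter> U \<subseteq> closure (T i)" .
  with U nonempty show thesis
    using that by simp
qed

section \<open>The use principle\<close>

lemma eventually_bounded_eval_Comp:
  assumes "length ys = length gs"
    and gs: "\<And>i. i < length gs \<Longrightarrow>
      \<forall>\<^sub>F (s, B) in sequentially \<times>\<^sub>F nhds A. bounded_eval B s (gs ! i) xs = Suc (ys ! i)"
    and h: "\<forall>\<^sub>F (s, B) in sequentially \<times>\<^sub>F nhds A. bounded_eval B s h ys = Suc y"
  shows "\<forall>\<^sub>F (s, B) in sequentially \<times>\<^sub>F nhds A. bounded_eval B s (Comp h gs) xs = Suc y"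
  unfolding case_prod_unfold
proof -
  have "\<forall>\<^sub>F z in sequentially \<times>\<^sub>F nhds A.
      \<forall>i\<in>{..<length gs}. bounded_eval (snd z) (fst z) (gs ! i) xs = Suc (ys ! i)"
    using gs by (intro eventually_ball_finite) (auto simp: case_prod_unfold)
  with h[unfolded case_prod_unfold]
  show "\<forall>\<^sub>F z in sequentially \<times>\<^sub>F nhds A. bounded_eval (snd z) (fst z) (Comp h gs) xs = Suc y"
  proof eventually_elim
    case (elim z)
    then have "map (\<lambda>g. bounded_eval (snd z) (fst z) g xs - 1) gs = ys"
      using assms(1) by (auto intro!: nth_equalityI)
    moreover have "bounded_eval (snd z) (fst z) g xs \<noteq> 0" if "g \<in> set gs" for g
      using that elim(2) by (auto simp: in_set_conv_nth)
    ultimately show ?case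
      using elim(1) by simp
  qed
qed

lemma eventually_bounded_eval_Mu:
  assumes stop: "\<forall>\<^sub>F (s, B) in sequentially \<times>\<^sub>F nhds A. bounded_eval B s p (n # xs) = 1"
    and continue: "\<And>m. m < n \<Longrightarrow>
      \<forall>\<^sub>F (s, B) in sequentially \<times>\<^sub>F nhds A. \<not> bounded_eval B s p (m # xs) \<le> 1"
  shows "\<forall>\<^sub>F (s, B) in sequentially \<times>\<^sub>F nhds A. bounded_eval B s (Mu p) xs = Suc n"
  unfolding case_prod_unfold
proof -
  have "\<forall>\<^sub>F z in sequentially \<times>\<^sub>F nhds A.
      \<forall>m\<in>{..<n}. \<not> bounded_eval (snd z) (fst z) p (m # xs) \<le> 1"
    using continue by (intro eventually_ball_finite) (auto simp: case_prod_unfold)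
  moreover have "\<forall>\<^sub>F z in sequentially \<times>\<^sub>F nhds A. n \<le> fst z"
    by (rule eventually_compose_filterlim[OF eventually_ge_at_top filterlim_fst])
  ultimately show "\<forall>\<^sub>F z in sequentially \<times>\<^sub>F nhds A. bounded_eval (snd z) (fst z) (Mu p) xs = Suc n"
    using stop[unfolded case_prod_unfold]
  proof eventually_elim
    case (elim z)
    have "(LEAST n. fst z \<le> n \<or> bounded_eval (snd z) (fst z) p (n # xs) \<le> 1) = n"
    proof (rule Least_equality)
      show "n \<le> m" if "fst z \<le> m \<or> bounded_eval (snd z) (fst z) p (m # xs) \<le> 1" for m
        using that elim(1,2) by (meson le_trans lessThan_iff not_le)
    qed (simp add: elim(3))
    with elim(3) show ?case
      by simp
  qed
qed

lemma eventually_bounded_eval: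
  assumes "computes A p xs y"
  shows "\<forall>\<^sub>F (s, B) in sequentially \<times>\<^sub>F nhds A. bounded_eval B s p xs = Suc y"
  using assms unfolding case_prod_unfold
proof (induction rule: computes.induct)
  case (query x)
  have "\<forall>\<^sub>F z in sequentially \<times>\<^sub>F nhds A. snd z x = A x"
    by (rule eventually_compose_filterlim[OF eventually_nhds_coordinate_eq filterlim_snd])
  then show ?case
    by eventually_elim simp
next
  case (comp ys gs xs h w)
  show ?case
    by (rule eventually_bounded_eval_Comp[unfolded case_prod_unfold, OF comp.hyps(1)])
      (use comp.IH in auto)
next
  case (rec_Suc g h n xs r y)
  from rec_Suc.IH show ?case
    by eventually_elim (simp cong: if_cong)
next
  case (mu p n xs)
  have "\<forall>\<^sub>F z in sequentially \<times>\<^sub>F nhds A. \<not> bounded_eval (snd z) (fst z) p (m # xs) \<le> 1"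
    if m: "m < n" for m
  proof -
    obtain k where "\<forall>\<^sub>F z in sequentially \<times>\<^sub>F nhds A.
        bounded_eval (snd z) (fst z) p (m # xs) = Suc (Suc k)"
      using mu.IH(2)[OF m] by blast
    then show ?thesis
      by eventually_elim simp
  qed
  with mu.IH(1) show ?case
    using eventually_bounded_eval_Mu[of p n xs A] by (simp add: case_prod_unfold)
qed simp_all

lemma open_computes: "open {A. computes A p xs y}"
proof (subst open_subopen, safe)
  fix A assume "computes A p xs y"
  from eventually_bounded_eval[OF this] obtain P Q where P: "\<forall>\<^sub>F s in sequentially. P s"
    and Q: "\<forall>\<^sub>F B in nhds A. Q B" and eval: "\<And>s B. P s \<Longrightarrow> Q B \<Longrightarrow> bounded_eval B s p xs = Suc y"
    unfolding eventually_prod_filter by auto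
  obtain s where "P s"
    using eventually_happens[OF P] by auto
  from Q have "\<forall>\<^sub>F B in nhds A. computes B p xs y"
    by eventually_elim (rule bounded_eval_sound[OF eval[OF \<open>P s\<close>]])
  then show "\<exists>T. open T \<and> A \<in> T \<and> T \<subseteq> {A. computes A p xs y}"
    unfolding eventually_nhds by blast
qed

section \<open>Pullbacks below every oracle\<close>

instance prog :: countable
  by countable_datatype

lemma compact_cantor_space: "compact cantor_space"
proof -
  have "cantor_space = (\<Pi>\<^sub>E i\<in>UNIV. {0, 1})"
    by (simp add: cantor_space_def PiE_UNIV_domain Pi_def)
  then show ?thesis
    using compactin_PiE[of "\<lambda>_. euclidean" UNIV "\<lambda>_::nat. {0, 1::nat}"]
    by (simp add: euclidean_product_topology finite_imp_compact)
qed

definition cylinder :: "(nat \<Rightarrow> nat) \<Rightarrow> nat \<Rightarrow> (nat \<Rightarrow> nat) set" where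
  "cylinder C l = {D \<in> cantor_space. \<forall>i<l. D i = C i}"

definition pullback_oracles :: "(nat \<Rightarrow> nat) \<Rightarrow> prog \<Rightarrow> (nat \<Rightarrow> nat) set" where
  "pullback_oracles k p = {D \<in> cantor_space. \<forall>n. computes D p [n] (pullback k D n)}"

lemma pullback_oracles_somewhere_dense:
  assumes "\<And>C. C \<in> cantor_space \<Longrightarrow> pullback k C \<le>\<^sub>T C"
  obtains p C l where "C \<in> cantor_space" "cylinder C l \<subseteq> closure (pullback_oracles k p)"
proof -
  have "cantor_space = (\<Union>p. pullback_oracles k p)"
    using assms by (auto simp: pullback_oracles_def turing_le_def)
  moreover have "cantor_space \<noteq> {}"
    by (auto simp: cantor_space_def intro: exI[of _ "\<lambda>_. 0"])
  ultimately obtain p U where U: "open U" "cantor_space \<inter> U \<noteq> {}"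
    "cantor_space \<inter> U \<subseteq> closure (pullback_oracles k p)"
    using compact_countable_cover_somewhere_dense[OF compact_cantor_space] by metis
  then obtain C where C: "C \<in> cantor_space" "C \<in> U"
    by blast
  then obtain l where "\<And>D. (\<forall>i<l. D i = C i) \<Longrightarrow> D \<in> U"
    using open_contains_cylinder[OF U(1)] by blast
  with U(3) C(1) show thesis
    by (intro that[of C l p]) (auto simp: cylinder_def)
qed

lemma bit_eq_if_computes_on_closure:
  assumes "D \<in> closure (pullback_oracles k p)" "computes D p [n] y"
  shows "D (k n) = y"
proof -
  have "open ({E. computes E p [n] y} \<inter> {E. \<forall>i\<in>{k n}. E i = D i})"
    by (intro open_Int open_computes open_agree_on_finite) simp
  then obtain E where E: "E \<in> pullback_oracles k p" "computes E p [n] y" "E (k n) = D (k n)"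
    using assms by (fastforce dest: open_Int_closure_eq_empty[of _ "pullback_oracles k p"])
  then have "computes E p [n] (D (k n))"
    unfolding pullback_oracles_def pullback_def by (metis (no_types, lifting) mem_Collect_eq)
  with E(2) show ?thesis
    by (rule computes_unique[symmetric])
qed

lemma ex_oracle_answers_follow_bit:
  assumes dense: "cylinder C l \<subseteq> closure (pullback_oracles k p)"
    and C: "C \<in> cantor_space" and l: "l \<le> k n"
  obtains D where "D \<in> cylinder C l" "\<And>b. b \<in> {0, 1} \<Longrightarrow> computes (D(k n := b)) p [n] b"
proof -
  let ?m = "k n"
  have meets: "\<exists>D \<in> cylinder C l \<inter> U. D ?m = b \<and> computes D p [n] b"
    if E: "E \<in> cylinder C l" "E ?m = b" "E \<in> U" and U: "open U" for E b U
  proof -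
    have "open (U \<inter> {D. \<forall>i\<in>insert ?m {..<l}. D i = E i})"
      by (intro open_Int U open_agree_on_finite) simp
    then obtain D where D: "D \<in> pullback_oracles k p" "D \<in> U" "\<forall>i\<in>insert ?m {..<l}. D i = E i"
      using E dense by (fastforce dest: open_Int_closure_eq_empty[of _ "pullback_oracles k p"])
    then have "D ?m = b"
      using E(2) by simp
    moreover have "computes D p [n] (D ?m)"
      using D(1) by (simp add: pullback_oracles_def pullback_def)
    ultimately show ?thesis
      using D E(1) by (intro bexI[of _ D]) (auto simp: cylinder_def pullback_oracles_def)
  qed
  have update_in_cylinder: "E(?m := b) \<in> cylinder C l" if "E \<in> cylinder C l" "b \<in> {0, 1}" for E b
    using that l by (auto simp: cylinder_def cantor_space_def)
  have "C \<in> cylinder C l"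
    using C by (simp add: cylinder_def)
  then obtain E where E: "E \<in> cylinder C l" "E ?m = 1" "computes E p [n] 1"
    using meets[of "C(?m := 1)" 1 UNIV] update_in_cylinder by auto
  \<comment> \<open>\<open>D\<close> is chosen so close to \<open>E(?m := 0)\<close> that \<open>D(?m := 1)\<close> still answers \<open>1\<close>, as \<open>E\<close> does.\<close>
  let ?U = "(\<lambda>B. B(?m := 1)) -` {B. computes B p [n] 1}"
  have "open ?U"
    by (intro open_vimage open_computes continuous_on_fun_upd)
  moreover have "E(?m := 0) \<in> ?U"
    using E by (simp add: fun_upd_idem)
  ultimately obtain D where D: "D \<in> cylinder C l" "D \<in> ?U" "D ?m = 0" "computes D p [n] 0"
    using meets[of "E(?m := 0)" 0 ?U] E(1) update_in_cylinder by auto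
  then have "computes (D(?m := b)) p [n] b" if "b \<in> {0, 1}" for b
    using that by (auto simp: fun_upd_idem)
  with D(1) show thesis
    by (rule that)
qed

text \<open>The code \<open>w\<close> lists a position followed by the bits of an oracle.\<close>

definition coded_oracle :: "(nat \<Rightarrow> nat) \<Rightarrow> nat \<Rightarrow> nat \<Rightarrow> nat \<Rightarrow> nat \<Rightarrow> nat" where
  "coded_oracle C l b w x =
    (if x < l then C x else if x = entry w 0 then b else of_bool (entry w (Suc x) \<noteq> 0))"

lemma coded_oracle_in_cylinder:
  "C \<in> cantor_space \<Longrightarrow> b \<in> {0, 1} \<Longrightarrow> coded_oracle C l b w \<in> cylinder C l"
  by (auto simp: coded_oracle_def cylinder_def cantor_space_def)

lemma recursive_in_coded_oracle:
  "recursive_in A 2 (\<lambda>ys. coded_oracle C l b (ys ! 0) (ys ! 1))"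
proof -
  have "recursive_in A 2 (\<lambda>ys. if ys ! 1 \<in> {..<l} then C (ys ! 1)
      else if ys ! 1 = entry (ys ! 0) 0 then b
      else if entry (ys ! 0) (Suc (ys ! 1)) = 0 then 0 else 1)"
    by (intro recursive_in_finite_cases recursive_intros) simp_all
  then show ?thesis
    by (rule recursive_in_cong) (simp add: coded_oracle_def)
qed

definition locates :: "(nat \<Rightarrow> nat) \<Rightarrow> nat \<Rightarrow> prog \<Rightarrow> nat \<Rightarrow> nat \<Rightarrow> bool" where
  "locates C l p n w \<longleftrightarrow> (\<forall>b\<in>{0, 1}. bounded_eval (coded_oracle C l b w) w p [n] = Suc b)"

lemma decidable_in_locates:
  assumes "recursive_in A n F" "recursive_in A n G"
  shows "decidable_in A n (\<lambda>xs. locates C l p (F xs) (G xs))"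
proof -
  have "recursive_list_in A n (Suc 0) (\<lambda>xs. [F xs])"
    by (intro recursive_intros assms)
  then have "recursive_in A n (\<lambda>xs. bounded_eval (coded_oracle C l b (G xs)) (G xs) p [F xs])" for b
    using assms(2)
    by (intro recursive_in_bounded_eval[OF
          uniformly_evaluable_in_recursive_oracle[OF recursive_in_coded_oracle]])
  then show ?thesis
    unfolding locates_def by (intro decidable_in_ball decidable_in_eq recursive_in_const) simp_all
qed

lemma entry_eq_if_locates:
  assumes dense: "cylinder C l \<subseteq> closure (pullback_oracles k p)" and C: "C \<in> cantor_space"
    and locates: "locates C l p n w"
  shows "entry w 0 = k n"
proof (rule ccontr)
  assume "entry w 0 \<noteq> k n"
  then have "coded_oracle C l 0 w (k n) = coded_oracle C l 1 w (k n)"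
    by (simp add: coded_oracle_def)
  moreover have "coded_oracle C l b w (k n) = b" if b: "b \<in> {0, 1}" for b
  proof -
    have "computes (coded_oracle C l b w) p [n] b"
      using locates b unfolding locates_def by (blast intro: bounded_eval_sound)
    moreover have "coded_oracle C l b w \<in> closure (pullback_oracles k p)"
      using dense coded_oracle_in_cylinder[OF C b] by blast
    ultimately show ?thesis
      by (blast intro: bit_eq_if_computes_on_closure)
  qed
  ultimately show False
    by simp
qed

lemma ex_codes_tendsto:
  assumes "D \<in> cylinder C l" "l \<le> m"
  obtains w where "filterlim w at_top sequentially"
    and "\<And>b. (\<lambda>u. coded_oracle C l b (w u)) \<longlonglongrightarrow> D(m := b)"
proof -
  have "\<exists>w\<ge>u. \<forall>i<Suc u. entry w i = (case i of 0 \<Rightarrow> m | Suc x \<Rightarrow> D x)" for u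
    by (rule ex_code_ge)
  then obtain w where w: "\<And>u. u \<le> w u"
    "\<And>u i. i < Suc u \<Longrightarrow> entry (w u) i = (case i of 0 \<Rightarrow> m | Suc x \<Rightarrow> D x)"
    by metis
  show thesis
  proof (rule that)
    show "filterlim w at_top sequentially"
      by (rule filterlim_at_top_mono[OF filterlim_ident]) (simp add: w(1))
    show "(\<lambda>u. coded_oracle C l b (w u)) \<longlonglongrightarrow> D(m := b)" for b
    proof (rule tendsto_if_agree_below)
      fix u x :: nat assume "x < u"
      then have "entry (w u) 0 = m" "entry (w u) (Suc x) = D x"
        using w(2)[of _ u] by simp_all
      moreover have "D x \<in> {0, 1}" "x < l \<Longrightarrow> D x = C x"
        using assms(1) by (auto simp: cylinder_def cantor_space_def)
      ultimately show "coded_oracle C l b (w u) x = (D(m := b)) x"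
        using assms(2) by (auto simp: coded_oracle_def)
    qed
  qed
qed

lemma ex_locates:
  assumes "cylinder C l \<subseteq> closure (pullback_oracles k p)" "C \<in> cantor_space" "l \<le> k n"
  shows "\<exists>w. locates C l p n w"
proof -
  obtain D where D: "D \<in> cylinder C l" "\<And>b. b \<in> {0, 1} \<Longrightarrow> computes (D(k n := b)) p [n] b"
    using ex_oracle_answers_follow_bit[OF assms] by metis
  obtain w where w: "filterlim w at_top sequentially"
    "\<And>b. (\<lambda>u. coded_oracle C l b (w u)) \<longlonglongrightarrow> D(k n := b)"
    using ex_codes_tendsto[OF D(1) assms(3)] by metis
  have "\<forall>\<^sub>F u in sequentially. bounded_eval (coded_oracle C l b (w u)) (w u) p [n] = Suc b"
    if "b \<in> {0, 1}" for b
    using eventually_compose_filterlim[OF eventually_bounded_eval[OF D(2)[OF that]]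
        filterlim_Pair[OF w]]
    by simp
  then have "\<forall>\<^sub>F u in sequentially. locates C l p n (w u)"
    unfolding locates_def by (intro eventually_ball_finite) auto
  from eventually_happens[OF this] show ?thesis
    by auto
qed

lemma decidable_in_fibre:
  assumes "\<And>C. C \<in> cantor_space \<Longrightarrow> pullback k C \<le>\<^sub>T C"
  shows "decidable_in A 1 (\<lambda>xs. k (xs ! 0) = j)"
proof -
  have "pullback k (\<lambda>x. of_bool (x = j)) \<le>\<^sub>T (\<lambda>x. of_bool (x = j))"
    by (rule assms) (simp add: cantor_space_def)
  moreover have "(\<lambda>x. of_bool (x = j)) \<le>\<^sub>T A"
    unfolding turing_le_iff_recursive_in decidable_in_def[symmetric]
    by (intro recursive_intros) simp
  ultimately have "pullback k (\<lambda>x. of_bool (x = j)) \<le>\<^sub>T A"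
    by (rule turing_le_trans)
  then show ?thesis
    by (simp add: turing_le_iff_recursive_in decidable_in_def pullback_def)
qed

theorem turing_le_if_pullback_le:
  assumes "\<And>C. C \<in> cantor_space \<Longrightarrow> pullback k C \<le>\<^sub>T C"
  shows "k \<le>\<^sub>T A"
proof -
  obtain p C l where C: "C \<in> cantor_space"
    and dense: "cylinder C l \<subseteq> closure (pullback_oracles k p)"
    using pullback_oracles_somewhere_dense[OF assms] by metis
  have fibre: "decidable_in A 1 (\<lambda>xs. k (xs ! 0) = j)" for j
    using assms by (rule decidable_in_fibre)
  then have "decidable_in A 1 (\<lambda>xs. k (xs ! 0) \<in> {..<l})"
    by (intro decidable_in_mem_finite) auto
  then have below: "decidable_in A (Suc 1) (\<lambda>ys. k (drop 1 ys ! 0) \<in> {..<l})"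
    unfolding decidable_in_def using recursive_in_drop[of A 1 _ 1] by simp
  have ex_code: "\<exists>w. k n \<in> {..<l} \<or> locates C l p n w" for n
    using ex_locates[OF dense C, of n] by (cases "k n < l") auto
  have "recursive_in A 1 (\<lambda>xs. if k (xs ! 0) \<in> {..<l} then k (xs ! 0)
      else entry (LEAST w. k (xs ! 0) \<in> {..<l} \<or> locates C l p (xs ! 0) w) 0)"
    by (intro recursive_in_finite_cases[of _ _ _ _ _ "\<lambda>x. x"] fibre decidable_in_locates below
        recursive_intros ex_code) simp_all
  moreover have "entry (LEAST w. k n \<in> {..<l} \<or> locates C l p n w) 0 = k n" if "k n \<notin> {..<l}" for n
    using LeastI_ex[OF ex_code, of n] that entry_eq_if_locates[OF dense C] by blast
  ultimately show ?thesis
    unfolding turing_le_iff_recursive_in by (elim recursive_in_cong) simp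
qed

section \<open>Automorphisms induced by permutations\<close>

lemma pullback_in_cantor_space: "A \<in> cantor_space \<Longrightarrow> pullback f A \<in> cantor_space"
  by (simp add: cantor_space_def pullback_def)

lemma pullback_pullback: "pullback f (pullback g A) = pullback (g \<circ> f) A"
  by (simp add: pullback_def fun_eq_iff)

lemma turing_degree_eqI:
  assumes "A \<in> cantor_space" "B \<in> cantor_space" "A \<le>\<^sub>T B" "B \<le>\<^sub>T A"
  shows "turing_degree A = turing_degree B"
  unfolding turing_degree_def
  by (rule equiv_class_eq[OF equiv_turing_equiv]) (simp add: turing_equiv_def assms)

lemma induced_automorphism_pullback_le:
  assumes "induced_by \<pi> f" "degree_automorphism \<pi>" "A \<in> cantor_space" "B \<in> cantor_space" "A \<le>\<^sub>T B"
  shows "pullback f A \<le>\<^sub>T pullback f B"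
proof -
  have "turing_degree C \<in> turing_degrees" if "C \<in> cantor_space" for C
    using that unfolding turing_degrees_def turing_degree_def by (rule quotientI)
  moreover have "degree_le (turing_degree A) (turing_degree B)"
    using assms(3-5) by (simp add: degree_le_turing_degree)
  ultimately have "degree_le (\<pi> (turing_degree A)) (\<pi> (turing_degree B))"
    using assms(2-4) unfolding degree_automorphism_def by blast
  then show ?thesis
    using assms(1,3,4)
    by (simp add: induced_by_def degree_le_turing_degree pullback_in_cantor_space)
qed

lemma induced_automorphism_pullback_conjugate_le:
  assumes "bij f" "induced_by \<pi> f" "degree_automorphism \<pi>" "C \<in> cantor_space" and g: "\<And>A. g \<le>\<^sub>T A"
  shows "pullback (inv f \<circ> g \<circ> f) C \<le>\<^sub>T C"
proof -
  define B where "B = pullback (inv f) C"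
  have "pullback f (pullback g B) \<le>\<^sub>T pullback f B"
    using assms(2-4) turing_le_pullback[OF g turing_le_refl]
    by (simp add: B_def induced_automorphism_pullback_le pullback_in_cantor_space)
  moreover have "pullback f (pullback g B) = pullback (inv f \<circ> g \<circ> f) C"
    by (simp add: B_def pullback_pullback comp_assoc)
  moreover have "pullback f B = C"
    using assms(1) by (simp add: B_def pullback_def bij_is_inj)
  ultimately show ?thesis
    by simp
qed

lemma turing_le_inv_if_conjugate_Suc:
  assumes "bij f" "inv f \<circ> Suc \<circ> f \<le>\<^sub>T A"
  shows "inv f \<le>\<^sub>T A"
proof -
  have "((inv f \<circ> Suc \<circ> f) ^^ n) (inv f 0) = inv f n" for n
    by (induction n) (simp_all add: bij_is_surj[OF assms(1)] surj_f_inv_f)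
  moreover have "recursive_in A 1 (\<lambda>xs. ((inv f \<circ> Suc \<circ> f) ^^ (xs ! 0)) (inv f 0))"
    by (intro recursive_in_funpow[OF assms(2)] recursive_intros) simp
  ultimately show ?thesis
    by (simp only: turing_le_iff_recursive_in)
qed

lemma turing_le_if_inv_turing_le:
  assumes "bij f" "inv f \<le>\<^sub>T A"
  shows "f \<le>\<^sub>T A"
proof -
  have inv: "inv f w = n \<longleftrightarrow> w = f n" for w n
    using assms(1) by (metis bij_inv_eq_iff)
  have "recursive_in A 1 (\<lambda>xs. LEAST w. inv f w = xs ! 0)"
    by (intro recursive_in_apply[OF assms(2)] recursive_intros) (simp_all add: inv)
  moreover have "(LEAST w. inv f w = n) = f n" for n
    by (rule Least_equality) (simp_all add: inv)
  ultimately show ?thesis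
    by (simp add: turing_le_iff_recursive_in)
qed

lemma turing_degree_pullback:
  assumes "bij f" "A \<in> cantor_space" and f: "\<And>B. f \<le>\<^sub>T B" and inv: "\<And>B. inv f \<le>\<^sub>T B"
  shows "turing_degree (pullback f A) = turing_degree A"
proof (rule turing_degree_eqI)
  show "pullback f A \<le>\<^sub>T A"
    by (rule turing_le_pullback[OF f turing_le_refl])
  have "pullback (inv f) (pullback f A) = A"
    using assms(1) by (simp add: pullback_def bij_is_surj surj_f_inv_f)
  then show "A \<le>\<^sub>T pullback f A"
    using turing_le_pullback[OF inv turing_le_refl, of "pullback f A"] by simp
qed (simp_all add: assms(2) pullback_in_cantor_space)

theorem theorem5p1:
  fixes f :: "nat \<Rightarrow> nat"
    and \<pi> :: "(nat \<Rightarrow> nat) set \<Rightarrow> (nat \<Rightarrow> nat) set"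
  assumes "bij f"
    and "induced_by \<pi> f"
    and "degree_automorphism \<pi>"
  shows "\<forall>p\<in>turing_degrees. \<pi> p = p"
proof
  have "pullback (inv f \<circ> Suc \<circ> f) C \<le>\<^sub>T C" if "C \<in> cantor_space" for C
    using assms that turing_le_Suc by (rule induced_automorphism_pullback_conjugate_le)
  then have "inv f \<circ> Suc \<circ> f \<le>\<^sub>T A" for A
    by (rule turing_le_if_pullback_le)
  then have inv: "inv f \<le>\<^sub>T A" for A
    by (rule turing_le_inv_if_conjugate_Suc[OF assms(1)])
  then have f: "f \<le>\<^sub>T A" for A
    by (rule turing_le_if_inv_turing_le[OF assms(1)])
  fix p assume "p \<in> turing_degrees"
  then obtain A where A: "A \<in> cantor_space" "p = turing_degree A"
    unfolding turing_degrees_def turing_degree_def by (auto elim: quotientE)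
  then have "\<pi> p = turing_degree (pullback f A)"
    using assms(2) by (simp add: induced_by_def)
  also have "\<dots> = p"
    using A turing_degree_pullback[OF assms(1) _ f inv] by simp
  finally show "\<pi> p = p" .
qed

end
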